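(* Let $c\in\mathbb{R}\langle\langle X\rangle\rangle$ and $\mathbf{x},\mathbf{y}\in G$. Then $$(c@\mathbf{x})@\mathbf{y}=c@(\mathbf{x}\odot\mathbf{y}),\qquad c@\mathbf{e}=c,$$ where $\mathbf{e}=[1\;\;0]^t$ is the identity element of $(G,\odot)$. Thus the affine feedback product $@$ is a right action of the group $(G,\odot)$ on the set $\mathbb{R}\langle\langle X\rangle\rangle$.
   Context: Let $X=\{x_0,x_1\}$ be an alphabet of two non-commuting letters, $X^*$ the set of words in $X$ (including the empty word, written $\emptyset$ or $\mathbf{1}$), and $\mathbb{R}\langle\langle X\rangle\rangle$ the space of formal power series $c=\sum_{\eta\in X^*}c(\eta)\eta$ with $c(\eta)\in\mathbb{R}$. Juxtaposition of a letter and a series denotes left concatenation. The symbol $\sqcup\!\sqcup$ denotes the usual shuffle product on $\mathbb{R}\langle\langle X\rangle\rangle$ (dual to the coproduct for which the letters are primitive), with unit $\emptyset$, also written $1$; $c(\mathbf 1)$ is the constant coefficient of $c$. The composition product of $c,d\in\mathbb{R}\langle\langle X\rangle\rangle$ is $c\circ d=\sum_{\eta\in X^*}c(\eta)\,(\eta\circ d)$, where for words $\eta\in X^*$, inductively, $$\emptyset\circ d=\emptyset,\quad (x_0\eta)\circ d=x_0(\eta\circ d),\quad (x_1\eta)\circ d=x_0\big(d\sqcup\!\sqcup(\eta\circ d)\big).$$ Let $G=\{\mathbf{c}=[c_1\;\;c_2]^t\in\mathbb{R}\langle\langle X\rangle\rangle^2: c_1(\mathbf{1})=1\}$ and $\mathbf{e}=[1\;\;0]^t$.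 For $c\in\mathbb{R}\langle\langle X\rangle\rangle$ and $\mathbf{d}=[d_1\;\;d_2]^t\in G$, the mixed composition product is $c\,\tilde{\circ}\,\mathbf{d}=\sum_{\eta\in X^*}c(\eta)(\eta\,\tilde{\circ}\,\mathbf{d})$, where inductively $$\emptyset\,\tilde{\circ}\,\mathbf{d}=\emptyset,\quad (x_0\eta)\,\tilde{\circ}\,\mathbf{d}=x_0(\eta\,\tilde{\circ}\,\mathbf{d}),\quad (x_1\eta)\,\tilde{\circ}\,\mathbf{d}=x_1\big(d_1\sqcup\!\sqcup(\eta\,\tilde{\circ}\,\mathbf{d})\big)+x_0\big(d_2\sqcup\!\sqcup(\eta\,\tilde{\circ}\,\mathbf{d})\big).$$ Componentwise: $\mathbf{d}\,\bar{\circ}\,c=[d_1\circ c\;\;\;d_2\circ c]^t$ and $\mathbf{c}\triangleleft\mathbf{d}=[c_1\,\tilde{\circ}\,\mathbf{d}\;\;\;c_2\,\tilde{\circ}\,\mathbf{d}]^t$, both in $G$. On $G$ define two products $$\mathbf{c}\odot\mathbf{d}=[\,c_1\sqcup\!\sqcup d_1\;\;\;c_2+(d_2\sqcup\!\sqcup c_1)\,]^t,\qquad \mathbf{c}\star\mathbf{d}=(\mathbf{c}\triangleleft\mathbf{d})\odot\mathbf{d}.$$ It is known that $(G,\odot)$ and $(G,\star)$ are groups, both with identity $\mathbf{e}$; inverses are written $\mathbf{c}^{\odot-1}$ and $\mathbf{c}^{\star-1}$. For $c\in\mathbb{R}\langle\langle X\rangle\rangle$ and $\mathbf{d}\in G$,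 the affine feedback product is $$c@\mathbf{d}=c\,\tilde{\circ}\,\Big(\big(\mathbf{d}^{\odot-1}\big)\,\bar{\circ}\,c\Big)^{\star-1}\in\mathbb{R}\langle\langle X\rangle\rangle .$$ *)

theory Defs
  imports Complex_Main "HOL-Library.Groups_Big_Fun" "HOL-Algebra.Group"
begin

datatype letter = X0 | X1

type_synonym word = "letter list"

type_synonym series = "word \<Rightarrow> real"

definition one_series :: series where
  "one_series = (\<lambda>w. if w = [] then 1 else 0)"

definition zero_series :: series where
  "zero_series = (\<lambda>w. 0)"

definition series_add :: "series \<Rightarrow> series \<Rightarrow> series" (infixl \<open>+\<^sub>s\<close> 65) where
  "c +\<^sub>s d = (\<lambda>w. c w + d w)"

definition left_concat :: "letter \<Rightarrow> series \<Rightarrow> series" where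
  "left_concat x c = (\<lambda>w. case w of [] \<Rightarrow> 0 | y # v \<Rightarrow> if y = x then c v else 0)"

text \<open>The value of the coproduct on a word, as the list (with multiplicity) of the pairs
  \<open>(u, v)\<close> for which \<open>u \<otimes> v\<close> occurs in it. The coproduct is multiplicative for concatenation
  and the letters are primitive, so its value on \<open>x w\<close> is the product of
  \<open>x \<otimes> 1 + 1 \<otimes> x\<close> and its value on \<open>w\<close>.
  The usual recursion of the shuffle product on words is \<open>shuffle_words\<close> below.\<close>

primrec coproduct :: "word \<Rightarrow> (word \<times> word) list" where
  "coproduct [] = [([], [])]"
| "coproduct (x # w) =
     map (\<lambda>(u, v). (x # u, v)) (coproduct w) @ map (\<lambda>(u, v). (u, x # v)) (coproduct w)"

definition shuffle :: "series \<Rightarrow> series \<Rightarrow> series" (infixl \<open>\<squnion>\<squnion>\<close> 70) where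
  "c \<squnion>\<squnion> d = (\<lambda>w. \<Sum>(u, v)\<leftarrow>coproduct w. c u * d v)"

primrec word_comp :: "word \<Rightarrow> series \<Rightarrow> series" where
  "word_comp [] d = one_series"
| "word_comp (x # \<eta>) d =
     (case x of
        X0 \<Rightarrow> left_concat X0 (word_comp \<eta> d)
      | X1 \<Rightarrow> left_concat X0 (d \<squnion>\<squnion> word_comp \<eta> d))"

text \<open>For each fixed \<open>w\<close> the sum has finite support (see \<open>finite_support_word_comp\<close>), so
  \<^const>\<open>Sum_any\<close> is the sum over all words.\<close>

definition comp_prod :: "series \<Rightarrow> series \<Rightarrow> series" (infixl \<open>\<circ>\<^sub>c\<close> 75) where
  "c \<circ>\<^sub>c d = (\<lambda>w. Sum_any (\<lambda>\<eta>. c \<eta> * word_comp \<eta> d w))"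

definition G :: "(series \<times> series) set" where
  "G = {c. fst c [] = 1}"

definition e_G :: "series \<times> series" where
  "e_G = (one_series, zero_series)"

primrec word_mixed :: "word \<Rightarrow> series \<times> series \<Rightarrow> series" where
  "word_mixed [] d = one_series"
| "word_mixed (x # \<eta>) d =
     (case x of
        X0 \<Rightarrow> left_concat X0 (word_mixed \<eta> d)
      | X1 \<Rightarrow> left_concat X1 (fst d \<squnion>\<squnion> word_mixed \<eta> d) +\<^sub>s left_concat X0 (snd d \<squnion>\<squnion> word_mixed \<eta> d))"

definition mixed_prod :: "series \<Rightarrow> series \<times> series \<Rightarrow> series" (infixl \<open>\<circ>\<^sub>m\<close> 75) where
  "c \<circ>\<^sub>m d = (\<lambda>w. Sum_any (\<lambda>\<eta>. c \<eta> * word_mixed \<eta> d w))"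

definition bar_comp :: "series \<times> series \<Rightarrow> series \<Rightarrow> series \<times> series" (infixl \<open>\<circ>\<^sub>b\<close> 75) where
  "d \<circ>\<^sub>b c = (fst d \<circ>\<^sub>c c, snd d \<circ>\<^sub>c c)"

definition pair_mixed ::
    "series \<times> series \<Rightarrow> series \<times> series \<Rightarrow> series \<times> series" (infixl \<open>\<lhd>\<^sub>m\<close> 75) where
  "c \<lhd>\<^sub>m d = (fst c \<circ>\<^sub>m d, snd c \<circ>\<^sub>m d)"

definition odot :: "series \<times> series \<Rightarrow> series \<times> series \<Rightarrow> series \<times> series" (infixl \<open>\<odot>\<close> 70) where
  "c \<odot> d = (fst c \<squnion>\<squnion> fst d, snd c +\<^sub>s (snd d \<squnion>\<squnion> fst c))"

definition star :: "series \<times> series \<Rightarrow> series \<times> series \<Rightarrow> series \<times> series" (infixl \<open>\<star>\<close> 70) where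
  "c \<star> d = (c \<lhd>\<^sub>m d) \<odot> d"

definition G_odot :: "(series \<times> series) monoid" where
  "G_odot = \<lparr>carrier = G, mult = (\<odot>), one = e_G\<rparr>"

definition G_star :: "(series \<times> series) monoid" where
  "G_star = \<lparr>carrier = G, mult = (\<star>), one = e_G\<rparr>"

definition feedback :: "series \<Rightarrow> series \<times> series \<Rightarrow> series" (infixl \<open>@\<^sub>f\<close> 75) where
  "c @\<^sub>f d = c \<circ>\<^sub>m (inv\<^bsub>G_star\<^esub> ((inv\<^bsub>G_odot\<^esub> d) \<circ>\<^sub>b c))"

definition right_action ::
    "('g, 'm) monoid_scheme \<Rightarrow> 'e set \<Rightarrow> ('e \<Rightarrow> 'g \<Rightarrow> 'e) \<Rightarrow> bool" where
  "right_action A E \<phi> \<longleftrightarrow>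
     group A \<and>
     (\<forall>p\<in>E. \<forall>g\<in>carrier A. \<phi> p g \<in> E) \<and>
     (\<forall>p\<in>E. \<forall>g\<in>carrier A. \<forall>h\<in>carrier A. \<phi> (\<phi> p g) h = \<phi> p (g \<otimes>\<^bsub>A\<^esub> h)) \<and>
     (\<forall>p\<in>E. \<phi> p \<one>\<^bsub>A\<^esub> = p)"


definition word_series :: "word \<Rightarrow> series" where
  "word_series u = (\<lambda>w. if w = u then 1 else 0)"

lemma shuffle_Nil: "(c \<squnion>\<squnion> d) [] = c [] * d []"
  by (simp add: shuffle_def)

lemma shuffle_Cons:
  "(c \<squnion>\<squnion> d) (x # w) = ((\<lambda>u. c (x # u)) \<squnion>\<squnion> d) w + (c \<squnion>\<squnion> (\<lambda>v. d (x # v))) w"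
  by (simp add: shuffle_def o_def case_prod_unfold)

lemma shuffle_zero: "(\<lambda>_. 0) \<squnion>\<squnion> d = (\<lambda>_. 0)" "c \<squnion>\<squnion> (\<lambda>_. 0) = (\<lambda>_. 0)"
  by (simp_all add: shuffle_def case_prod_unfold)

lemma shuffle_one: "one_series \<squnion>\<squnion> c = c" "c \<squnion>\<squnion> one_series = c"
proof -
  have "(one_series \<squnion>\<squnion> c) w = c w" for w
    by (induction w arbitrary: c)
       (simp_all add: shuffle_Nil shuffle_Cons one_series_def shuffle_zero)
  moreover have "(c \<squnion>\<squnion> one_series) w = c w" for w
    by (induction w arbitrary: c)
       (simp_all add: shuffle_Nil shuffle_Cons one_series_def shuffle_zero)
  ultimately show "one_series \<squnion>\<squnion> c = c" "c \<squnion>\<squnion> one_series = c"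
    by auto
qed

lemma shuffle_words:
  "word_series (x # u) \<squnion>\<squnion> word_series (y # v) =
     left_concat x (word_series u \<squnion>\<squnion> word_series (y # v)) +\<^sub>s left_concat y (word_series (x # u) \<squnion>\<squnion> word_series v)"
proof
  fix w
  have tl: "(\<lambda>t. word_series (a # s) (b # t)) = (if b = a then word_series s else (\<lambda>_. 0))" for a b s
    by (auto simp: word_series_def)
  show "(word_series (x # u) \<squnion>\<squnion> word_series (y # v)) w =
     (left_concat x (word_series u \<squnion>\<squnion> word_series (y # v)) +\<^sub>s left_concat y (word_series (x # u) \<squnion>\<squnion> word_series v)) w"
  proof (cases w)
    case Nil
    then show ?thesis by (simp add: shuffle_Nil series_add_def left_concat_def word_series_def)
  next
    case (Cons b t)
    then show ?thesis by (simp add: shuffle_Cons series_add_def left_concat_def tl shuffle_zero)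
  qed
qed


lemma coproduct_length: "(u, v) \<in> set (coproduct w) \<Longrightarrow> length u + length v = length w"
  by (induction w arbitrary: u v) auto

lemma shuffle_eq_0:
  assumes "\<And>v. length v < n \<Longrightarrow> d v = 0" and "length w < n"
  shows "(c \<squnion>\<squnion> d) w = 0"
proof -
  have "(case p of (u, v) \<Rightarrow> c u * d v) = 0" if "p \<in> set (coproduct w)" for p
  proof (cases p)
    case (Pair u v)
    with that have "length v < n" using coproduct_length[of u v w] assms(2) by simp
    with assms(1) Pair show ?thesis by simp
  qed
  then have "map (\<lambda>(u, v). c u * d v) (coproduct w) = map (\<lambda>_. 0) (coproduct w)"
    by (intro map_cong refl) blast
  then show ?thesis by (simp only: shuffle_def sum_list_0)
qed

lemma word_comp_eq_0: "length w < length \<eta> \<Longrightarrow> word_comp \<eta> d w = 0"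
proof (induction \<eta> arbitrary: w)
  case (Cons x \<eta>)
  then show ?case
    by (cases w; cases x) (auto simp: left_concat_def intro!: shuffle_eq_0[where n = "length \<eta>"])
qed simp

lemma word_mixed_eq_0: "length w < length \<eta> \<Longrightarrow> word_mixed \<eta> d w = 0"
proof (induction \<eta> arbitrary: w)
  case (Cons x \<eta>)
  then have "(c \<squnion>\<squnion> word_mixed \<eta> d) v = 0" if "length v < length \<eta>" for c v
    using that by (intro shuffle_eq_0[where n = "length \<eta>"]) auto
  with Cons show ?case
    by (cases w; cases x) (auto simp: left_concat_def series_add_def)
qed simp

lemma finite_words: "finite {\<eta> :: word. length \<eta> \<le> n}"
proof -
  have "(UNIV :: letter set) = {X0, X1}" using letter.exhaust by auto
  then have "finite (UNIV :: letter set)" by (metis finite.emptyI finite.insertI)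
  from finite_lists_length_le[OF this, of n] show ?thesis by simp
qed

lemma finite_support_word_comp: "finite {\<eta>. c \<eta> * word_comp \<eta> d w \<noteq> 0}"
  by (rule finite_subset[OF _ finite_words[of "length w"]])
     (auto simp: not_less[symmetric] word_comp_eq_0)

lemma finite_support_word_mixed: "finite {\<eta>. c \<eta> * word_mixed \<eta> d w \<noteq> 0}"
  by (rule finite_subset[OF _ finite_words[of "length w"]])
     (auto simp: not_less[symmetric] word_mixed_eq_0)

end

theory Submission
  imports Defs
begin

text \<open>Everything rests on one observation: \<open>z = c @\<^sub>f x\<close> is the only series that satisfies the
  feedback equation \<open>z = c \<circ>\<^sub>m (x \<circ>\<^sub>b z)\<close>. The right-hand side is a contraction, since its
  coefficients at words of length \<open>n\<close> involve only coefficients of \<open>z\<close> at words shorter than \<open>n\<close>,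
  so the equation has exactly one solution.

  Suppose \<open>z = c \<circ>\<^sub>m (x \<circ>\<^sub>b z)\<close> and \<open>z' = z \<circ>\<^sub>m (y \<circ>\<^sub>b z')\<close>. The laws
  \<open>(c \<circ>\<^sub>m d) \<circ>\<^sub>m e = c \<circ>\<^sub>m (d \<star> e)\<close> and \<open>(x \<circ>\<^sub>b z) \<lhd>\<^sub>m e = x \<circ>\<^sub>b (z \<circ>\<^sub>m e)\<close>, together with the
  fact that \<open>x \<mapsto> x \<circ>\<^sub>b z\<close> respects \<open>\<odot>\<close>, give \<open>z' = c \<circ>\<^sub>m ((x \<odot> y) \<circ>\<^sub>b z')\<close>
  (lemma \<open>feedback_equation_odot\<close>). By uniqueness this is the action law.

  To identify \<open>c @\<^sub>f x\<close> with the solution \<open>z\<close>, one has to see that \<open>x \<circ>\<^sub>b z\<close> is the inverse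
  for \<open>\<star>\<close> of \<open>x\<^sup>-\<^sup>1 \<circ>\<^sub>b c\<close>. The action law for solutions, applied to \<open>x\<close> and \<open>x\<^sup>-\<^sup>1\<close>, shows that
  \<open>c = z \<circ>\<^sub>m (x\<^sup>-\<^sup>1 \<circ>\<^sub>b c)\<close>, and both inverse identities follow. Thus only the monoid structure
  of \<open>(G, \<star>)\<close> is needed, and inverses in it exist where the feedback product uses them.

  The algebraic laws are proved by comparing the left shifts \<open>w \<mapsto> c (a w)\<close> of both sides, by
  induction on the length up to which coefficients are compared.\<close>

\<comment> \<open>From here on \<open>\<circ>\<^sub>m\<close> is the mixed composition product only, not composition of partial maps.\<close>
no_notation map_comp (infixl \<open>\<circ>\<^sub>m\<close> 55)

section \<open>Series up to a given length\<close>

text \<open>The left shift, adjoint to left concatenation: it removes the letter \<open>a\<close> from the front of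
  the words that begin with it, and deletes the other words.\<close>

definition shift :: "letter \<Rightarrow> series \<Rightarrow> series" where
  "shift a c = (\<lambda>w. c (a # w))"

text \<open>Equality of the coefficients of all words shorter than \<open>n\<close>.\<close>

definition agree :: "nat \<Rightarrow> series \<Rightarrow> series \<Rightarrow> bool" where
  "agree n c d \<longleftrightarrow> (\<forall>w. length w < n \<longrightarrow> c w = d w)"

lemma agree_0 [simp]: "agree 0 c d"
  by (simp add: agree_def)

lemma agree_refl [simp]: "agree n c c"
  by (simp add: agree_def)

lemma agree_sym: "agree n c d \<Longrightarrow> agree n d c"
  by (simp add: agree_def)

lemma agree_trans: "agree n c d \<Longrightarrow> agree n d e \<Longrightarrow> agree n c e"
  by (simp add: agree_def)

lemma agree_mono: "agree n c d \<Longrightarrow> m \<le> n \<Longrightarrow> agree m c d"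
  by (simp add: agree_def)

lemma agree_Suc:
  "agree (Suc n) c d \<longleftrightarrow>
     c [] = d [] \<and> agree n (shift X0 c) (shift X0 d) \<and> agree n (shift X1 c) (shift X1 d)"
proof -
  have *: "agree n (shift a c) (shift a d) \<longleftrightarrow> (\<forall>w. length w < n \<longrightarrow> c (a # w) = d (a # w))" for a
    by (simp add: agree_def shift_def)
  show ?thesis
  proof
    assume "agree (Suc n) c d"
    then show "c [] = d [] \<and> agree n (shift X0 c) (shift X0 d) \<and> agree n (shift X1 c) (shift X1 d)"
      by (simp add: agree_def shift_def)
  next
    assume R: "c [] = d [] \<and> agree n (shift X0 c) (shift X0 d) \<and> agree n (shift X1 c) (shift X1 d)"
    have "c w = d w" if "length w < Suc n" for w
    proof (cases w)
      case Nil
      with R show ?thesis by simp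
    next
      case (Cons a v)
      with R that show ?thesis unfolding * by (cases a) auto
    qed
    then show "agree (Suc n) c d" by (simp add: agree_def)
  qed
qed

lemma series_eqI: "(\<And>n. agree n c d) \<Longrightarrow> c = d"
  by (rule ext) (metis agree_def lessI)

lemma agree_add: "agree n c c' \<Longrightarrow> agree n d d' \<Longrightarrow> agree n (c +\<^sub>s d) (c' +\<^sub>s d')"
  by (simp add: agree_def series_add_def)

text \<open>Banach's fixed point theorem for maps that determine one more length of coefficients.\<close>

lemma contraction_fixpoint:
  fixes F :: "series \<Rightarrow> series"
  assumes F: "\<And>n z z'. agree n z z' \<Longrightarrow> agree (Suc n) (F z) (F z')"
  obtains z where "z = F z"
proof -
  define Z where "Z n = (F ^^ n) zero_series" for n
  define z where "z w = Z (Suc (length w)) w" for w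
  have step: "agree n (Z n) (Z (n + k))" for n k
    by (induction n) (simp_all add: Z_def F)
  have lim: "agree n z (Z n)" for n
    unfolding agree_def
  proof (intro allI impI)
    fix w :: word
    assume "length w < n"
    then obtain k where k: "n = Suc (length w) + k"
      using less_iff_Suc_add by auto
    show "z w = Z n w"
      using step[of "Suc (length w)" k] unfolding z_def k agree_def by blast
  qed
  have "agree n z (F z)" for n
  proof -
    have "agree (Suc n) (F z) (Z (Suc n))"
      using F[OF lim[of n]] by (simp add: Z_def)
    then have "agree (Suc n) z (F z)"
      using lim[of "Suc n"] agree_sym agree_trans by blast
    then show ?thesis by (rule agree_mono) simp
  qed
  then have "z = F z" by (rule series_eqI)
  then show thesis by (rule that)
qed

lemma contraction_unique:
  assumes F: "\<And>n z z'. agree n z z' \<Longrightarrow> agree (Suc n) (F z) (F z')"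
    and z: "z = F z" and z': "z' = F z'"
  shows "z = z'"
proof (rule series_eqI)
  show "agree n z z'" for n
  proof (induction n)
    case (Suc n)
    from F[OF this] show ?case using z z' by simp
  qed simp
qed

section \<open>The shuffle algebra\<close>

lemma add_assoc: "(a +\<^sub>s b) +\<^sub>s c = a +\<^sub>s (b +\<^sub>s c)"
  by (simp add: series_add_def add_ac)

lemma add_commute: "a +\<^sub>s b = b +\<^sub>s a"
  by (simp add: series_add_def add_ac)

lemma add_left_commute: "a +\<^sub>s (b +\<^sub>s c) = b +\<^sub>s (a +\<^sub>s c)"
  by (simp add: series_add_def add_ac)

lemma add_zero [simp]: "a +\<^sub>s zero_series = a" "zero_series +\<^sub>s a = a"
  by (simp_all add: series_add_def zero_series_def)

lemmas add_ac = add_assoc add_commute add_left_commute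

lemma shift_add: "shift a (c +\<^sub>s d) = shift a c +\<^sub>s shift a d"
  by (simp add: shift_def series_add_def)

lemma shift_one: "shift a one_series = zero_series"
  by (simp add: shift_def one_series_def zero_series_def)

lemma shift_shuffle: "shift a (c \<squnion>\<squnion> d) = (shift a c \<squnion>\<squnion> d) +\<^sub>s (c \<squnion>\<squnion> shift a d)"
  unfolding shift_def series_add_def by (simp only: shuffle_Cons)

lemma shuffle_zero_series [simp]: "zero_series \<squnion>\<squnion> d = zero_series" "c \<squnion>\<squnion> zero_series = zero_series"
  by (simp_all add: zero_series_def shuffle_zero)

lemma shuffle_commute: "c \<squnion>\<squnion> d = d \<squnion>\<squnion> c"
proof
  show "(c \<squnion>\<squnion> d) w = (d \<squnion>\<squnion> c) w" for w
    by (induction w arbitrary: c d) (simp_all add: shuffle_Nil shuffle_Cons)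
qed

lemma shuffle_add_right: "c \<squnion>\<squnion> (d +\<^sub>s e) = (c \<squnion>\<squnion> d) +\<^sub>s (c \<squnion>\<squnion> e)"
  by (simp add: shuffle_def series_add_def case_prod_unfold distrib_left sum_list_addf)

lemma shuffle_add_left: "(d +\<^sub>s e) \<squnion>\<squnion> c = (d \<squnion>\<squnion> c) +\<^sub>s (e \<squnion>\<squnion> c)"
  by (simp add: shuffle_commute[of _ c] shuffle_add_right)

lemma shuffle_scale_right: "c \<squnion>\<squnion> (\<lambda>v. r * d v) = (\<lambda>w. r * (c \<squnion>\<squnion> d) w)"
  by (simp add: shuffle_def case_prod_unfold mult.left_commute sum_list_const_mult)

lemma shuffle_sum_right:
  "finite S \<Longrightarrow> c \<squnion>\<squnion> (\<lambda>v. \<Sum>i\<in>S. f i v) = (\<lambda>w. \<Sum>i\<in>S. (c \<squnion>\<squnion> f i) w)"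
proof (induction S rule: finite_induct)
  case (insert i S)
  have "c \<squnion>\<squnion> (\<lambda>v. \<Sum>j\<in>insert i S. f j v) = c \<squnion>\<squnion> (f i +\<^sub>s (\<lambda>v. \<Sum>j\<in>S. f j v))"
    using insert.hyps by (simp add: series_add_def)
  also have "\<dots> = (\<lambda>w. \<Sum>j\<in>insert i S. (c \<squnion>\<squnion> f j) w)"
    using insert by (simp only: shuffle_add_right) (simp add: series_add_def)
  finally show ?case .
qed (simp add: shuffle_zero)

lemma agree_shuffle:
  assumes "agree n c c'" "agree n d d'"
  shows "agree n (c \<squnion>\<squnion> d) (c' \<squnion>\<squnion> d')"
  unfolding agree_def shuffle_def
proof (intro allI impI arg_cong[where f = sum_list] map_cong refl)
  fix w p
  assume "length w < n" "p \<in> set (coproduct w)"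
  then show "(case p of (u, v) \<Rightarrow> c u * d v) = (case p of (u, v) \<Rightarrow> c' u * d' v)"
    using assms coproduct_length[of "fst p" "snd p" w] by (cases p) (simp add: agree_def)
qed

lemma agree_shuffle_proper:
  assumes "p [] = 0" "agree n d d'"
  shows "agree (Suc n) (p \<squnion>\<squnion> d) (p \<squnion>\<squnion> d')"
  unfolding agree_def shuffle_def
proof (intro allI impI arg_cong[where f = sum_list] map_cong refl)
  fix w q
  assume "length w < Suc n" "q \<in> set (coproduct w)"
  then have "fst q = [] \<or> length (snd q) < n"
    using coproduct_length[of "fst q" "snd q" w] by (cases q; cases "fst q") auto
  then show "(case q of (u, v) \<Rightarrow> p u * d v) = (case q of (u, v) \<Rightarrow> p u * d' v)"
    using assms by (auto simp: agree_def case_prod_unfold)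
qed

lemma shuffle_assoc: "(c \<squnion>\<squnion> d) \<squnion>\<squnion> e = c \<squnion>\<squnion> (d \<squnion>\<squnion> e)"
proof (rule series_eqI)
  show "agree n ((c \<squnion>\<squnion> d) \<squnion>\<squnion> e) (c \<squnion>\<squnion> (d \<squnion>\<squnion> e))" for n
    by (induction n arbitrary: c d e)
      (auto simp: agree_Suc shuffle_Nil shift_shuffle shuffle_add_left shuffle_add_right add_assoc
        intro!: agree_add)
qed

lemma shuffle_left_commute: "c \<squnion>\<squnion> (d \<squnion>\<squnion> e) = d \<squnion>\<squnion> (c \<squnion>\<squnion> e)"
  by (metis shuffle_assoc shuffle_commute)

lemmas shuffle_ac = shuffle_assoc shuffle_commute shuffle_left_commute

text \<open>The inverse \<open>d\<close> of \<open>c = 1 - p\<close>, with \<open>p\<close> proper, is the fixed point of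
  \<open>d \<mapsto> 1 + p \<squnion>\<squnion> d\<close>.\<close>

lemma shuffle_inverse:
  assumes "c [] = 1"
  obtains d where "d \<squnion>\<squnion> c = one_series" "d [] = 1"
proof -
  define p :: series where "p = (\<lambda>w. one_series w - c w)"
  have p: "p [] = 0" "one_series = c +\<^sub>s p"
    using assms by (simp_all add: p_def one_series_def series_add_def)
  have "agree (Suc n) (one_series +\<^sub>s (p \<squnion>\<squnion> z)) (one_series +\<^sub>s (p \<squnion>\<squnion> z'))"
    if "agree n z z'" for n z z'
    using that p(1) by (intro agree_add agree_refl agree_shuffle_proper)
  then obtain d where d: "d = one_series +\<^sub>s (p \<squnion>\<squnion> d)"
    using contraction_fixpoint[of "\<lambda>d. one_series +\<^sub>s (p \<squnion>\<squnion> d)"] by blast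
  have "(c \<squnion>\<squnion> d) +\<^sub>s (p \<squnion>\<squnion> d) = one_series +\<^sub>s (p \<squnion>\<squnion> d)"
    using d by (simp add: shuffle_add_left[symmetric] p(2)[symmetric] shuffle_one)
  then have "c \<squnion>\<squnion> d = one_series"
    by (simp add: series_add_def fun_eq_iff)
  moreover from this have "d [] = 1"
    using assms shuffle_Nil[of c d] by (simp add: one_series_def)
  ultimately show thesis
    using that by (simp add: shuffle_commute)
qed

section \<open>Composition products through left shifts\<close>

text \<open>Both composition products extend a family of series indexed by words linearly to all
  series. The families are triangular: the member at \<open>\<eta>\<close> vanishes on words shorter than
  \<open>\<eta>\<close>, so the coefficients of such a combination are finite sums.\<close>

definition triangular :: "(word \<Rightarrow> series) \<Rightarrow> bool" where
  "triangular W \<longleftrightarrow> (\<forall>\<eta> w. length w < length \<eta> \<longrightarrow> W \<eta> w = 0)"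

text \<open>The combination \<open>\<Sum>\<eta>. c(\<eta>) W(\<eta>)\<close>, taken coefficientwise. It is the intended sum when
  each coefficient has only finitely many nonzero terms, as for triangular \<open>W\<close>.\<close>

definition lin_comb :: "series \<Rightarrow> (word \<Rightarrow> series) \<Rightarrow> series" where
  "lin_comb c W = (\<lambda>w. Sum_any (\<lambda>\<eta>. c \<eta> * W \<eta> w))"

lemma comp_prod_eq: "c \<circ>\<^sub>c d = lin_comb c (\<lambda>\<eta>. word_comp \<eta> d)"
  by (simp add: comp_prod_def lin_comb_def)

lemma mixed_prod_eq: "c \<circ>\<^sub>m d = lin_comb c (\<lambda>\<eta>. word_mixed \<eta> d)"
  by (simp add: mixed_prod_def lin_comb_def)

lemma triangular_word_comp: "triangular (\<lambda>\<eta>. word_comp \<eta> d)"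
  by (simp add: triangular_def word_comp_eq_0)

lemma triangular_word_mixed: "triangular (\<lambda>\<eta>. word_mixed \<eta> d)"
  by (simp add: triangular_def word_mixed_eq_0)

lemma triangular_Cons: "triangular W \<Longrightarrow> triangular (\<lambda>\<eta>. W (a # \<eta>))"
  by (simp add: triangular_def)

lemma triangular_shuffle: "triangular W \<Longrightarrow> triangular (\<lambda>\<eta>. d \<squnion>\<squnion> W \<eta>)"
  unfolding triangular_def by (metis shuffle_eq_0)

lemma lin_comb_eq_sum:
  assumes "triangular W" "length w \<le> n"
  shows "lin_comb c W w = (\<Sum>\<eta> | length \<eta> \<le> n. c \<eta> * W \<eta> w)"
  unfolding lin_comb_def
proof (rule Sum_any.expand_superset[OF finite_words])
  show "{\<eta>. c \<eta> * W \<eta> w \<noteq> 0} \<subseteq> {\<eta>. length \<eta> \<le> n}"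
    using assms unfolding triangular_def by (force simp: not_less[symmetric])
qed

lemma lin_comb_split:
  assumes "triangular W"
  shows "lin_comb c W w = c [] * W [] w
    + lin_comb (shift X0 c) (\<lambda>\<eta>. W (X0 # \<eta>)) w + lin_comb (shift X1 c) (\<lambda>\<eta>. W (X1 # \<eta>)) w"
proof -
  define L where "L = {\<eta> :: word. length \<eta> \<le> length w}"
  have fin: "finite L" unfolding L_def by (rule finite_words)
  have L: "{\<eta>. length \<eta> \<le> Suc (length w)} = insert [] ((#) X0 ` L \<union> (#) X1 ` L)"
  proof (rule Set.set_eqI)
    fix \<eta> :: word
    show "\<eta> \<in> {\<eta>. length \<eta> \<le> Suc (length w)} \<longleftrightarrow> \<eta> \<in> insert [] ((#) X0 ` L \<union> (#) X1 ` L)"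
    proof (cases \<eta>)
      case (Cons a v)
      then show ?thesis by (cases a) (auto simp: L_def)
    qed simp
  qed
  have "lin_comb c W w = (\<Sum>\<eta>\<in>insert [] ((#) X0 ` L \<union> (#) X1 ` L). c \<eta> * W \<eta> w)"
    using lin_comb_eq_sum[OF assms, of w "Suc (length w)"] L by simp
  also have "\<dots> = c [] * W [] w
      + ((\<Sum>\<eta>\<in>(#) X0 ` L. c \<eta> * W \<eta> w) + (\<Sum>\<eta>\<in>(#) X1 ` L. c \<eta> * W \<eta> w))"
    using fin by (subst sum.insert, simp, force, subst sum.union_disjoint) auto
  also have "(\<Sum>\<eta>\<in>(#) X0 ` L. c \<eta> * W \<eta> w) = lin_comb (shift X0 c) (\<lambda>\<eta>. W (X0 # \<eta>)) w"
    by (subst lin_comb_eq_sum[OF triangular_Cons[OF assms] order_refl])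
      (simp add: sum.reindex L_def shift_def)
  also have "(\<Sum>\<eta>\<in>(#) X1 ` L. c \<eta> * W \<eta> w) = lin_comb (shift X1 c) (\<lambda>\<eta>. W (X1 # \<eta>)) w"
    by (subst lin_comb_eq_sum[OF triangular_Cons[OF assms] order_refl])
      (simp add: sum.reindex L_def shift_def)
  finally show ?thesis by (simp add: add.assoc)
qed

lemma lin_comb_shuffle:
  assumes "triangular W"
  shows "lin_comb c (\<lambda>\<eta>. d \<squnion>\<squnion> W \<eta>) = d \<squnion>\<squnion> lin_comb c W"
proof
  fix w :: word
  let ?S = "\<lambda>v. \<Sum>\<eta> | length \<eta> \<le> length w. c \<eta> * W \<eta> v"
  have "agree (Suc (length w)) (lin_comb c W) ?S"
    using lin_comb_eq_sum[OF assms] by (simp add: agree_def)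
  then have "agree (Suc (length w)) (d \<squnion>\<squnion> lin_comb c W) (d \<squnion>\<squnion> ?S)"
    by (rule agree_shuffle[OF agree_refl])
  then have "(d \<squnion>\<squnion> lin_comb c W) w = (d \<squnion>\<squnion> ?S) w"
    by (simp only: agree_def lessI)
  also have "\<dots> = lin_comb c (\<lambda>\<eta>. d \<squnion>\<squnion> W \<eta>) w"
    by (simp add: shuffle_sum_right finite_words shuffle_scale_right
        lin_comb_eq_sum[OF triangular_shuffle[OF assms] order_refl])
  finally show "lin_comb c (\<lambda>\<eta>. d \<squnion>\<squnion> W \<eta>) w = (d \<squnion>\<squnion> lin_comb c W) w" by simp
qed

lemma lin_comb_add:
  assumes "triangular W"
  shows "lin_comb (c +\<^sub>s d) W = lin_comb c W +\<^sub>s lin_comb d W"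
  by (rule ext)
    (simp add: lin_comb_eq_sum[OF assms order_refl] series_add_def distrib_right sum.distrib)

lemma lin_comb_zero [simp]: "lin_comb zero_series W = zero_series"
  by (simp add: lin_comb_def zero_series_def)

lemma lin_comb_zero_right [simp]: "lin_comb c (\<lambda>_. zero_series) = zero_series"
  by (simp add: lin_comb_def zero_series_def)

lemma lin_comb_Nil:
  assumes "triangular W" "W [] = one_series"
  shows "lin_comb c W [] = c []"
proof -
  have "{\<eta> :: word. length \<eta> \<le> 0} = {[]}" by auto
  then show ?thesis
    using lin_comb_eq_sum[OF assms(1), of "[]" 0 c] assms(2) by (simp add: one_series_def)
qed

lemma shift_lin_comb:
  assumes "triangular W" "W [] = one_series"
  shows "shift a (lin_comb c W) =
    lin_comb (shift X0 c) (\<lambda>\<eta>. shift a (W (X0 # \<eta>))) +\<^sub>s lin_comb (shift X1 c) (\<lambda>\<eta>. shift a (W (X1 # \<eta>)))"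
proof
  fix w
  have *: "lin_comb d V (a # w) = lin_comb d (\<lambda>\<eta>. shift a (V \<eta>)) w" for d V
    by (simp add: lin_comb_def shift_def)
  have "shift a (lin_comb c W) w = lin_comb c W (a # w)" by (simp add: shift_def)
  also have "\<dots> = (lin_comb (shift X0 c) (\<lambda>\<eta>. shift a (W (X0 # \<eta>))) +\<^sub>s
      lin_comb (shift X1 c) (\<lambda>\<eta>. shift a (W (X1 # \<eta>)))) w"
    by (subst lin_comb_split[OF assms(1)]) (simp add: assms(2) * one_series_def series_add_def)
  finally show "shift a (lin_comb c W) w = \<dots>" .
qed

lemma shift_left_concat: "shift a (left_concat b c) = (if a = b then c else zero_series)"
  by (simp add: shift_def left_concat_def zero_series_def)

lemma comp_Nil: "(c \<circ>\<^sub>c d) [] = c []"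
  by (simp add: comp_prod_eq lin_comb_Nil triangular_word_comp)

lemma shift_comp:
  "shift X0 (c \<circ>\<^sub>c d) = (shift X0 c \<circ>\<^sub>c d) +\<^sub>s (d \<squnion>\<squnion> (shift X1 c \<circ>\<^sub>c d))"
  "shift X1 (c \<circ>\<^sub>c d) = zero_series"
  by (simp_all add: comp_prod_eq shift_lin_comb triangular_word_comp shift_left_concat lin_comb_shuffle)

lemma mixed_Nil: "(c \<circ>\<^sub>m d) [] = c []"
  by (simp add: mixed_prod_eq lin_comb_Nil triangular_word_mixed)

lemma shift_mixed:
  "shift X0 (c \<circ>\<^sub>m d) = (shift X0 c \<circ>\<^sub>m d) +\<^sub>s (snd d \<squnion>\<squnion> (shift X1 c \<circ>\<^sub>m d))"
  "shift X1 (c \<circ>\<^sub>m d) = fst d \<squnion>\<squnion> (shift X1 c \<circ>\<^sub>m d)"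
  by (simp_all add: mixed_prod_eq shift_lin_comb triangular_word_mixed shift_left_concat shift_add
      lin_comb_shuffle)

section \<open>Algebraic laws of the composition products\<close>

lemma comp_add: "(c +\<^sub>s c') \<circ>\<^sub>c d = (c \<circ>\<^sub>c d) +\<^sub>s (c' \<circ>\<^sub>c d)"
  by (simp add: comp_prod_eq lin_comb_add triangular_word_comp)

lemma mixed_add: "(c +\<^sub>s c') \<circ>\<^sub>m d = (c \<circ>\<^sub>m d) +\<^sub>s (c' \<circ>\<^sub>m d)"
  by (simp add: mixed_prod_eq lin_comb_add triangular_word_mixed)

lemma comp_zero [simp]: "zero_series \<circ>\<^sub>c d = zero_series"
  by (simp add: comp_prod_eq)

lemma mixed_zero [simp]: "zero_series \<circ>\<^sub>m d = zero_series"
  by (simp add: mixed_prod_eq)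

lemma series_eq_one:
  assumes "\<And>a. shift a c = zero_series" and "c [] = 1"
  shows "c = one_series"
proof (rule series_eqI)
  show "agree n c one_series" for n
    by (cases n) (simp_all add: agree_Suc shift_one assms, simp add: one_series_def)
qed

lemma comp_one [simp]: "one_series \<circ>\<^sub>c d = one_series"
proof (rule series_eq_one)
  show "shift a (one_series \<circ>\<^sub>c d) = zero_series" for a
    by (cases a) (simp_all add: shift_comp shift_one)
qed (simp only: comp_Nil, simp add: one_series_def)

lemma mixed_one [simp]: "one_series \<circ>\<^sub>m d = one_series"
proof (rule series_eq_one)
  show "shift a (one_series \<circ>\<^sub>m d) = zero_series" for a
    by (cases a) (simp_all add: shift_mixed shift_one)
qed (simp only: mixed_Nil, simp add: one_series_def)

lemma mixed_e_G [simp]: "c \<circ>\<^sub>m e_G = c"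
proof (rule series_eqI)
  show "agree n (c \<circ>\<^sub>m e_G) c" for n
    by (induction n arbitrary: c)
      (simp_all add: agree_Suc mixed_Nil shift_mixed e_G_def shuffle_one)
qed

lemma comp_shuffle: "(c \<squnion>\<squnion> d) \<circ>\<^sub>c e = (c \<circ>\<^sub>c e) \<squnion>\<squnion> (d \<circ>\<^sub>c e)"
proof (rule series_eqI)
  show "agree n ((c \<squnion>\<squnion> d) \<circ>\<^sub>c e) ((c \<circ>\<^sub>c e) \<squnion>\<squnion> (d \<circ>\<^sub>c e))" for n
  proof (induction n arbitrary: c d)
    case (Suc n)
    have "shift X0 ((c \<squnion>\<squnion> d) \<circ>\<^sub>c e) =
        (((shift X0 c \<squnion>\<squnion> d) \<circ>\<^sub>c e) +\<^sub>s ((c \<squnion>\<squnion> shift X0 d) \<circ>\<^sub>c e))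
        +\<^sub>s ((e \<squnion>\<squnion> ((shift X1 c \<squnion>\<squnion> d) \<circ>\<^sub>c e)) +\<^sub>s (e \<squnion>\<squnion> ((c \<squnion>\<squnion> shift X1 d) \<circ>\<^sub>c e)))"
      by (simp add: shift_comp shift_shuffle comp_add shuffle_add_right)
    moreover have "shift X0 ((c \<circ>\<^sub>c e) \<squnion>\<squnion> (d \<circ>\<^sub>c e)) =
        (((shift X0 c \<circ>\<^sub>c e) \<squnion>\<squnion> (d \<circ>\<^sub>c e)) +\<^sub>s ((c \<circ>\<^sub>c e) \<squnion>\<squnion> (shift X0 d \<circ>\<^sub>c e)))
        +\<^sub>s ((e \<squnion>\<squnion> ((shift X1 c \<circ>\<^sub>c e) \<squnion>\<squnion> (d \<circ>\<^sub>c e))) +\<^sub>s (e \<squnion>\<squnion> ((c \<circ>\<^sub>c e) \<squnion>\<squnion> (shift X1 d \<circ>\<^sub>c e))))"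
      by (simp add: shift_comp shift_shuffle shuffle_add_left shuffle_add_right shuffle_ac add_ac)
    ultimately have "agree n (shift X0 ((c \<squnion>\<squnion> d) \<circ>\<^sub>c e)) (shift X0 ((c \<circ>\<^sub>c e) \<squnion>\<squnion> (d \<circ>\<^sub>c e)))"
      by (simp only:) (intro agree_add agree_shuffle agree_refl Suc.IH)
    then show ?case
      by (simp add: agree_Suc comp_Nil shuffle_Nil shift_comp shift_shuffle)
  qed simp
qed

lemma mixed_shuffle: "(c \<squnion>\<squnion> d) \<circ>\<^sub>m e = (c \<circ>\<^sub>m e) \<squnion>\<squnion> (d \<circ>\<^sub>m e)"
proof (rule series_eqI)
  show "agree n ((c \<squnion>\<squnion> d) \<circ>\<^sub>m e) ((c \<circ>\<^sub>m e) \<squnion>\<squnion> (d \<circ>\<^sub>m e))" for n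
  proof (induction n arbitrary: c d)
    case (Suc n)
    have "shift X0 ((c \<squnion>\<squnion> d) \<circ>\<^sub>m e) =
        (((shift X0 c \<squnion>\<squnion> d) \<circ>\<^sub>m e) +\<^sub>s ((c \<squnion>\<squnion> shift X0 d) \<circ>\<^sub>m e))
        +\<^sub>s ((snd e \<squnion>\<squnion> ((shift X1 c \<squnion>\<squnion> d) \<circ>\<^sub>m e)) +\<^sub>s (snd e \<squnion>\<squnion> ((c \<squnion>\<squnion> shift X1 d) \<circ>\<^sub>m e)))"
      by (simp add: shift_mixed shift_shuffle mixed_add shuffle_add_right)
    moreover have "shift X0 ((c \<circ>\<^sub>m e) \<squnion>\<squnion> (d \<circ>\<^sub>m e)) =
        (((shift X0 c \<circ>\<^sub>m e) \<squnion>\<squnion> (d \<circ>\<^sub>m e)) +\<^sub>s ((c \<circ>\<^sub>m e) \<squnion>\<squnion> (shift X0 d \<circ>\<^sub>m e)))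
        +\<^sub>s ((snd e \<squnion>\<squnion> ((shift X1 c \<circ>\<^sub>m e) \<squnion>\<squnion> (d \<circ>\<^sub>m e)))
          +\<^sub>s (snd e \<squnion>\<squnion> ((c \<circ>\<^sub>m e) \<squnion>\<squnion> (shift X1 d \<circ>\<^sub>m e))))"
      by (simp add: shift_mixed shift_shuffle shuffle_add_left shuffle_add_right shuffle_ac add_ac)
    ultimately have 0: "agree n (shift X0 ((c \<squnion>\<squnion> d) \<circ>\<^sub>m e)) (shift X0 ((c \<circ>\<^sub>m e) \<squnion>\<squnion> (d \<circ>\<^sub>m e)))"
      by (simp only:) (intro agree_add agree_shuffle agree_refl Suc.IH)
    have "shift X1 ((c \<squnion>\<squnion> d) \<circ>\<^sub>m e) =
        (fst e \<squnion>\<squnion> ((shift X1 c \<squnion>\<squnion> d) \<circ>\<^sub>m e)) +\<^sub>s (fst e \<squnion>\<squnion> ((c \<squnion>\<squnion> shift X1 d) \<circ>\<^sub>m e))"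
      by (simp add: shift_mixed shift_shuffle mixed_add shuffle_add_right)
    moreover have "shift X1 ((c \<circ>\<^sub>m e) \<squnion>\<squnion> (d \<circ>\<^sub>m e)) =
        (fst e \<squnion>\<squnion> ((shift X1 c \<circ>\<^sub>m e) \<squnion>\<squnion> (d \<circ>\<^sub>m e))) +\<^sub>s (fst e \<squnion>\<squnion> ((c \<circ>\<^sub>m e) \<squnion>\<squnion> (shift X1 d \<circ>\<^sub>m e)))"
      by (simp add: shift_mixed shift_shuffle shuffle_ac)
    ultimately have "agree n (shift X1 ((c \<squnion>\<squnion> d) \<circ>\<^sub>m e)) (shift X1 ((c \<circ>\<^sub>m e) \<squnion>\<squnion> (d \<circ>\<^sub>m e)))"
      by (simp only:) (intro agree_add agree_shuffle agree_refl Suc.IH)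
    with 0 show ?case
      by (simp add: agree_Suc mixed_Nil shuffle_Nil)
  qed simp
qed

lemma comp_mixed: "(c \<circ>\<^sub>c d) \<circ>\<^sub>m e = c \<circ>\<^sub>c (d \<circ>\<^sub>m e)"
proof (rule series_eqI)
  show "agree n ((c \<circ>\<^sub>c d) \<circ>\<^sub>m e) (c \<circ>\<^sub>c (d \<circ>\<^sub>m e))" for n
  proof (induction n arbitrary: c)
    case (Suc n)
    have "shift X0 ((c \<circ>\<^sub>c d) \<circ>\<^sub>m e) =
        ((shift X0 c \<circ>\<^sub>c d) \<circ>\<^sub>m e) +\<^sub>s ((d \<circ>\<^sub>m e) \<squnion>\<squnion> ((shift X1 c \<circ>\<^sub>c d) \<circ>\<^sub>m e))"
      by (simp add: shift_mixed shift_comp mixed_add mixed_shuffle)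
    moreover have "shift X1 ((c \<circ>\<^sub>c d) \<circ>\<^sub>m e) = zero_series"
      by (simp add: shift_mixed shift_comp)
    ultimately show ?case
      by (simp add: agree_Suc mixed_Nil comp_Nil shift_comp(1)[of c "d \<circ>\<^sub>m e"]
          shift_comp(2)[of c "d \<circ>\<^sub>m e"] agree_add agree_shuffle Suc.IH)
  qed simp
qed

lemma mixed_mixed: "(c \<circ>\<^sub>m d) \<circ>\<^sub>m e = c \<circ>\<^sub>m (d \<star> e)"
proof (rule series_eqI)
  show "agree n ((c \<circ>\<^sub>m d) \<circ>\<^sub>m e) (c \<circ>\<^sub>m (d \<star> e))" for n
  proof (induction n arbitrary: c)
    case (Suc n)
    have "shift X0 ((c \<circ>\<^sub>m d) \<circ>\<^sub>m e) =
        ((shift X0 c \<circ>\<^sub>m d) \<circ>\<^sub>m e) +\<^sub>s (snd (d \<star> e) \<squnion>\<squnion> ((shift X1 c \<circ>\<^sub>m d) \<circ>\<^sub>m e))"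
      by (simp add: shift_mixed mixed_add mixed_shuffle star_def odot_def pair_mixed_def
          shuffle_add_left shuffle_add_right add_ac shuffle_ac)
    moreover have "shift X1 ((c \<circ>\<^sub>m d) \<circ>\<^sub>m e) = fst (d \<star> e) \<squnion>\<squnion> ((shift X1 c \<circ>\<^sub>m d) \<circ>\<^sub>m e)"
      by (simp add: shift_mixed mixed_shuffle star_def odot_def pair_mixed_def shuffle_ac)
    ultimately show ?case
      by (simp add: agree_Suc mixed_Nil shift_mixed[of c "d \<star> e"] agree_add agree_shuffle Suc.IH)
  qed simp
qed

lemma agree_comp:
  assumes "agree n d d'"
  shows "agree n (c \<circ>\<^sub>c d) (c \<circ>\<^sub>c d')"
  using assms
proof (induction n arbitrary: c)
  case (Suc n)
  then have "agree n d d'" by (simp add: agree_def)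
  with Suc.IH show ?case
    by (auto simp: agree_Suc[of n "c \<circ>\<^sub>c d"] comp_Nil shift_comp intro!: agree_add agree_shuffle)
qed simp

lemma agree_mixed:
  assumes "agree n (fst d) (fst d')" "agree n (snd d) (snd d')"
  shows "agree (Suc n) (c \<circ>\<^sub>m d) (c \<circ>\<^sub>m d')"
  using assms
proof (induction n arbitrary: c)
  case 0
  then show ?case by (simp add: agree_Suc mixed_Nil)
next
  case (Suc n)
  have "agree (Suc n) (c \<circ>\<^sub>m d) (c \<circ>\<^sub>m d')" for c
    by (rule Suc.IH; rule agree_mono[OF _ le_SucI[OF order_refl]]; rule Suc.prems)
  with Suc.prems show ?case
    by (auto simp: agree_Suc[of "Suc n" "c \<circ>\<^sub>m d"] mixed_Nil shift_mixed intro!: agree_add agree_shuffle)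
qed

section \<open>The group of pairs and the monoid of feedback transformations\<close>

lemma odot_assoc: "(x \<odot> y) \<odot> z = x \<odot> (y \<odot> z)"
  by (simp add: odot_def shuffle_ac shuffle_add_left shuffle_add_right add_ac)

lemma odot_e_G: "e_G \<odot> x = x" "x \<odot> e_G = x"
  by (simp_all add: odot_def e_G_def shuffle_one)

lemma odot_in_G: "x \<in> G \<Longrightarrow> y \<in> G \<Longrightarrow> x \<odot> y \<in> G"
  by (simp add: G_def odot_def shuffle_Nil)

lemma e_G_in_G: "e_G \<in> G"
  by (simp add: G_def e_G_def one_series_def)

lemma odot_left_inverse:
  assumes "x \<in> G"
  obtains y where "y \<in> G" "y \<odot> x = e_G"
proof -
  from assms have "fst x [] = 1" by (simp add: G_def)
  then obtain d where d: "d \<squnion>\<squnion> fst x = one_series" "d [] = 1" by (rule shuffle_inverse)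
  define y where "y = (d, \<lambda>w. - (snd x \<squnion>\<squnion> d) w)"
  have "y \<in> G" "y \<odot> x = e_G"
    using d by (simp_all add: y_def G_def odot_def e_G_def series_add_def zero_series_def)
  then show thesis by (rule that)
qed

lemma group_G_odot: "group G_odot"
proof (rule groupI)
  fix x assume "x \<in> carrier G_odot"
  then show "\<exists>y\<in>carrier G_odot. y \<otimes>\<^bsub>G_odot\<^esub> x = \<one>\<^bsub>G_odot\<^esub>"
    using odot_left_inverse[of x] by (auto simp: G_odot_def)
qed (auto simp: G_odot_def odot_in_G e_G_in_G odot_assoc odot_e_G)

lemma pair_mixed_odot: "(x \<odot> y) \<lhd>\<^sub>m d = (x \<lhd>\<^sub>m d) \<odot> (y \<lhd>\<^sub>m d)"
  by (simp add: pair_mixed_def odot_def mixed_shuffle mixed_add)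

lemma bar_comp_odot: "(x \<odot> y) \<circ>\<^sub>b c = (x \<circ>\<^sub>b c) \<odot> (y \<circ>\<^sub>b c)"
  by (simp add: bar_comp_def odot_def comp_shuffle comp_add)

lemma bar_comp_e_G [simp]: "e_G \<circ>\<^sub>b c = e_G"
  by (simp add: bar_comp_def e_G_def)

lemma bar_comp_in_G: "x \<in> G \<Longrightarrow> x \<circ>\<^sub>b c \<in> G"
  by (simp add: G_def bar_comp_def comp_Nil)

lemma bar_comp_pair_mixed: "(x \<circ>\<^sub>b c) \<lhd>\<^sub>m d = x \<circ>\<^sub>b (c \<circ>\<^sub>m d)"
  by (simp add: bar_comp_def pair_mixed_def comp_mixed)

lemma pair_mixed_in_G: "x \<in> G \<Longrightarrow> x \<lhd>\<^sub>m d \<in> G"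
  by (simp add: G_def pair_mixed_def mixed_Nil)

lemma monoid_G_star: "monoid G_star"
proof (rule monoidI)
  show "x \<otimes>\<^bsub>G_star\<^esub> y \<otimes>\<^bsub>G_star\<^esub> z = x \<otimes>\<^bsub>G_star\<^esub> (y \<otimes>\<^bsub>G_star\<^esub> z)" for x y z
  proof -
    have "(x \<lhd>\<^sub>m y) \<lhd>\<^sub>m z = x \<lhd>\<^sub>m (y \<star> z)"
      by (simp add: pair_mixed_def mixed_mixed)
    then show ?thesis
      by (simp add: G_star_def star_def pair_mixed_odot odot_assoc)
  qed
  show "\<one>\<^bsub>G_star\<^esub> \<otimes>\<^bsub>G_star\<^esub> x = x" for x
  proof -
    have "e_G \<lhd>\<^sub>m x = e_G" by (simp add: pair_mixed_def e_G_def)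
    then show ?thesis by (simp add: G_star_def star_def odot_e_G)
  qed
  show "x \<otimes>\<^bsub>G_star\<^esub> \<one>\<^bsub>G_star\<^esub> = x" for x
    by (simp add: G_star_def star_def pair_mixed_def odot_e_G)
qed (simp_all add: G_star_def star_def pair_mixed_in_G odot_in_G e_G_in_G)

section \<open>The feedback equation\<close>

lemma feedback_equation_contraction:
  "agree n z z' \<Longrightarrow> agree (Suc n) (c \<circ>\<^sub>m (x \<circ>\<^sub>b z)) (c \<circ>\<^sub>m (x \<circ>\<^sub>b z'))"
  by (rule agree_mixed) (simp_all add: bar_comp_def agree_comp)

lemma feedback_equation_solution:
  obtains z where "z = c \<circ>\<^sub>m (x \<circ>\<^sub>b z)"
  by (rule contraction_fixpoint[of "\<lambda>z. c \<circ>\<^sub>m (x \<circ>\<^sub>b z)"]) (rule feedback_equation_contraction)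

lemma feedback_equation_unique:
  "z = c \<circ>\<^sub>m (x \<circ>\<^sub>b z) \<Longrightarrow> z' = c \<circ>\<^sub>m (x \<circ>\<^sub>b z') \<Longrightarrow> z = z'"
  by (rule contraction_unique[of "\<lambda>z. c \<circ>\<^sub>m (x \<circ>\<^sub>b z)"]) (rule feedback_equation_contraction)

text \<open>Closing a loop through \<open>x\<close> and then one through \<open>y\<close> closes a loop through \<open>x \<odot> y\<close>.\<close>

lemma feedback_equation_odot:
  assumes z: "z = c \<circ>\<^sub>m (x \<circ>\<^sub>b z)" and z': "z' = z \<circ>\<^sub>m (y \<circ>\<^sub>b z')"
  shows "z' = c \<circ>\<^sub>m ((x \<odot> y) \<circ>\<^sub>b z')"
proof -
  have "z' = (c \<circ>\<^sub>m (x \<circ>\<^sub>b z)) \<circ>\<^sub>m (y \<circ>\<^sub>b z')"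
    using z z' by simp
  also have "\<dots> = c \<circ>\<^sub>m ((x \<circ>\<^sub>b (z \<circ>\<^sub>m (y \<circ>\<^sub>b z'))) \<odot> (y \<circ>\<^sub>b z'))"
    by (simp only: mixed_mixed star_def bar_comp_pair_mixed)
  also have "\<dots> = c \<circ>\<^sub>m ((x \<odot> y) \<circ>\<^sub>b z')"
    by (simp only: bar_comp_odot flip: z')
  finally show ?thesis .
qed

text \<open>Feedback through \<open>y = x\<^sup>-\<^sup>1\<close> undoes feedback through \<open>x\<close>.\<close>

lemma feedback_equation_undo:
  assumes z: "z = c \<circ>\<^sub>m (x \<circ>\<^sub>b z)" and inv: "x \<odot> y = e_G"
  shows "z \<circ>\<^sub>m (y \<circ>\<^sub>b c) = c"
proof -
  obtain z' where z': "z' = z \<circ>\<^sub>m (y \<circ>\<^sub>b z')" by (rule feedback_equation_solution)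
  have "z' = c" using feedback_equation_odot[OF z z'] inv by simp
  with z' show ?thesis by simp
qed

text \<open>The feedback product is the solution of the feedback equation: \<open>x \<circ>\<^sub>b z\<close> is a two-sided
  inverse of \<open>x\<^sup>-\<^sup>1 \<circ>\<^sub>b c\<close> for \<open>\<star>\<close>.\<close>

lemma feedback_eq_iff:
  assumes "x \<in> G"
  shows "c @\<^sub>f x = z \<longleftrightarrow> z = c \<circ>\<^sub>m (x \<circ>\<^sub>b z)"
proof -
  interpret odot: group G_odot by (rule group_G_odot)
  interpret star: monoid G_star by (rule monoid_G_star)
  define y where "y = inv\<^bsub>G_odot\<^esub> x"
  have y: "y \<in> G" "x \<odot> y = e_G" "y \<odot> x = e_G"
    using assms odot.inv_closed[of x] odot.r_inv[of x] odot.l_inv[of x]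
    by (simp_all add: y_def G_odot_def)
  obtain z\<^sub>0 where z\<^sub>0: "z\<^sub>0 = c \<circ>\<^sub>m (x \<circ>\<^sub>b z\<^sub>0)" by (rule feedback_equation_solution)
  have "(y \<circ>\<^sub>b c) \<star> (x \<circ>\<^sub>b z\<^sub>0) = (y \<odot> x) \<circ>\<^sub>b z\<^sub>0"
    by (simp only: star_def bar_comp_pair_mixed bar_comp_odot flip: z\<^sub>0)
  then have r: "(y \<circ>\<^sub>b c) \<star> (x \<circ>\<^sub>b z\<^sub>0) = e_G"
    using y by simp
  have "(x \<circ>\<^sub>b z\<^sub>0) \<star> (y \<circ>\<^sub>b c) = (x \<odot> y) \<circ>\<^sub>b c"
    by (simp only: star_def bar_comp_pair_mixed bar_comp_odot feedback_equation_undo[OF z\<^sub>0 y(2)])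
  then have l: "(x \<circ>\<^sub>b z\<^sub>0) \<star> (y \<circ>\<^sub>b c) = e_G"
    using y by simp
  have "x \<circ>\<^sub>b z\<^sub>0 = inv\<^bsub>G_star\<^esub> (y \<circ>\<^sub>b c)"
    by (rule star.inv_unique') (use l r assms y in \<open>simp_all add: G_star_def bar_comp_in_G\<close>)
  then have "c @\<^sub>f x = z\<^sub>0"
    using z\<^sub>0 by (simp add: feedback_def y_def)
  then show ?thesis
    using z\<^sub>0 feedback_equation_unique by metis
qed

lemma feedback_odot:
  assumes "x \<in> G" "y \<in> G"
  shows "(c @\<^sub>f x) @\<^sub>f y = c @\<^sub>f (x \<odot> y)"
proof -
  have "(c @\<^sub>f x) @\<^sub>f y = c \<circ>\<^sub>m ((x \<odot> y) \<circ>\<^sub>b ((c @\<^sub>f x) @\<^sub>f y))"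
    using assms feedback_eq_iff by (intro feedback_equation_odot) blast+
  then have "c @\<^sub>f (x \<odot> y) = (c @\<^sub>f x) @\<^sub>f y"
    using assms by (simp only: feedback_eq_iff odot_in_G)
  then show ?thesis by simp
qed

lemma feedback_e_G: "c @\<^sub>f e_G = c"
  by (simp add: feedback_eq_iff e_G_in_G)

theorem theorem4p12:
  fixes c :: series and x y :: "series \<times> series"
  assumes "x \<in> G" and "y \<in> G"
  shows "(c @\<^sub>f x) @\<^sub>f y = c @\<^sub>f (x \<odot> y) \<and> c @\<^sub>f e_G = c \<and>
         right_action G_odot (UNIV :: series set) (@\<^sub>f)"
proof (intro conjI)
  show "right_action G_odot (UNIV :: series set) (@\<^sub>f)"
    unfolding right_action_def
    using group_G_odot by (simp add: G_odot_def feedback_odot feedback_e_G)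
qed (use assms in \<open>simp_all add: feedback_odot feedback_e_G\<close>)

end
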